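(* Let $d,m\ge 1$, let $Q:\mathbb{R}^d\to\mathbb{R}^d$ be a contracting linear map and let $\mathcal{D}=(\mathcal{D}_{ij})_{1\le i,j\le m}$ be a digit set matrix for an iterated function system in $\mathbb{R}^d$ with common contraction $Q$. If $(A_1,A_2,\ldots,A_m)$ is a solution for $\mathcal{D}$, then for all $(t_1,t_2,\ldots,t_m)\in(\mathbb{R}^d)^m$ the tuple $(A_1+t_1,A_2+t_2,\ldots,A_m+t_m)$ is a solution for the digit set matrix $\big(\mathcal{D}_{ij}+(t_j-Qt_i)\big)_{1\le i,j\le m}$ (with the same common contraction $Q$).
   Context: A digit set matrix is an $m\times m$ matrix $\mathcal{D}=(\mathcal{D}_{ij})_{1\le i,j\le m}$ whose entries are finite (possibly empty) subsets of $\mathbb{R}^d$. A solution for $\mathcal{D}$ (with common contraction $Q$) is a tuple $(A_1,\ldots,A_m)$ of nonempty compact subsets of $\mathbb{R}^d$ satisfying the iterated function system $$A_j=\bigcup_{i=1}^m\big(QA_i+\mathcal{D}_{ij}\big)\qquad(1\le j\le m),$$ where for a set $B$ and a digit set $\mathcal{E}$ the expression $B+\mathcal{E}$ stands for the union of the translates $B+e$, $e\in\mathcal{E}$ (so $B+\varnothing=\varnothing$). For a digit set $\mathcal{D}_{ij}$ and a vector $v$, $\mathcal{D}_{ij}+v=\{e+v : e\in\mathcal{D}_{ij}\}$. *)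

theory Defs
  imports "HOL-Analysis.Analysis"
begin

text \<open>
  The dimension \<open>d \<ge> 1\<close> is \<open>CARD('d)\<close> and the number \<open>m \<ge> 1\<close> of sets is \<open>CARD('m)\<close>,
  for index types \<open>'d\<close>, \<open>'m\<close> of class \<open>finite\<close>; an \<open>m\<close>-tuple is a function on \<open>'m\<close>.
\<close>

definition norm_fun :: "(real ^ 'd \<Rightarrow> real) \<Rightarrow> bool" where
  "norm_fun N \<longleftrightarrow>
     (\<forall>x. 0 \<le> N x) \<and> (\<forall>x. N x = 0 \<longleftrightarrow> x = 0) \<and>
     (\<forall>c x. N (c *\<^sub>R x) = \<bar>c\<bar> * N x) \<and> (\<forall>x y. N (x + y) \<le> N x + N y)"

text \<open>
  The contraction factor may be measured in any norm on \<open>\<real>\<^sup>d\<close>, the Euclidean one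
  being a special case: inverses of expanding matrices contract in a suitable norm,
  but in general not in the Euclidean one.
\<close>

definition contracting_linear :: "(real ^ 'd \<Rightarrow> real ^ 'd) \<Rightarrow> bool" where
  "contracting_linear Q \<longleftrightarrow>
     linear Q \<and> (\<exists>N c. norm_fun N \<and> 0 \<le> c \<and> c < 1 \<and> (\<forall>x y. N (Q x - Q y) \<le> c * N (x - y)))"

definition digit_set_matrix :: "('m::finite \<Rightarrow> 'm \<Rightarrow> (real ^ 'd) set) \<Rightarrow> bool" where
  "digit_set_matrix D \<longleftrightarrow> (\<forall>i j. finite (D i j))"

definition translate :: "(real ^ 'd) set \<Rightarrow> real ^ 'd \<Rightarrow> (real ^ 'd) set" where
  "translate B v = (\<lambda>x. x + v) ` B"

definition translates :: "(real ^ 'd) set \<Rightarrow> (real ^ 'd) set \<Rightarrow> (real ^ 'd) set" where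
  "translates B E = (\<Union>e\<in>E. translate B e)"

definition ifs_solution ::
  "(real ^ 'd \<Rightarrow> real ^ 'd) \<Rightarrow> ('m::finite \<Rightarrow> 'm \<Rightarrow> (real ^ 'd) set) \<Rightarrow>
   ('m \<Rightarrow> (real ^ 'd) set) \<Rightarrow> bool" where
  "ifs_solution Q D A \<longleftrightarrow>
     (\<forall>j. A j \<noteq> {} \<and> compact (A j)) \<and>
     (\<forall>j. A j = (\<Union>i\<in>UNIV. translates (Q ` A i) (D i j)))"

end

theory Submission
  imports Defs
begin

text \<open>Linearity gives Q(A_i + t_i) = Q A_i + Q t_i, and the shift t_j - Q t_i of the digits
  cancels Q t_i and leaves t_j, which does not depend on i. So every piece of the j-th union moves
  by the same vector t_j (\<open>translates_linear_translate\<close>), and since translation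
  commutes with unions (\<open>translate_UN\<close>), the whole union moves by t_j. Translation also
  keeps sets finite, nonempty and compact.\<close>

lemma translate_UN: "translate (\<Union>i\<in>I. B i) v = (\<Union>i\<in>I. translate (B i) v)"
  by (simp add: translate_def image_UN)

text \<open>Pointwise this is Q(x + s) + (e + t - Q s) = (Q x + e) + t for x in \<open>B\<close> and
  e in \<open>E\<close>; for empty \<open>E\<close> both sides are empty.\<close>

lemma translates_linear_translate:
  assumes "linear Q"
  shows "translates (Q ` translate B s) (translate E (t - Q s)) = translate (translates (Q ` B) E) t"
  by (simp add: translates_def translate_def image_UN image_image linear_add[OF assms] algebra_simps)

lemma compact_translate: "compact B \<Longrightarrow> compact (translate B v)"
  by (auto simp: translate_def intro!: compact_continuous_image continuous_intros)

theorem theorem1p3: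
  fixes Q :: "real ^ 'd \<Rightarrow> real ^ 'd"
    and D :: "'m::finite \<Rightarrow> 'm \<Rightarrow> (real ^ 'd) set"
    and A :: "'m \<Rightarrow> (real ^ 'd) set"
  assumes "contracting_linear Q"
    and "digit_set_matrix D"
    and "ifs_solution Q D A"
  shows "\<forall>t :: 'm \<Rightarrow> real ^ 'd.
    digit_set_matrix (\<lambda>i j. translate (D i j) (t j - Q (t i))) \<and>
    ifs_solution Q (\<lambda>i j. translate (D i j) (t j - Q (t i))) (\<lambda>j. translate (A j) (t j))"
proof (intro allI conjI)
  fix t :: "'m \<Rightarrow> real ^ 'd"
  have Q: "linear Q"
    using assms(1) by (simp add: contracting_linear_def)
  have A: "A j \<noteq> {}" "compact (A j)" "A j = (\<Union>i\<in>UNIV. translates (Q ` A i) (D i j))" for j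
    using assms(3) unfolding ifs_solution_def by blast+
  show "digit_set_matrix (\<lambda>i j. translate (D i j) (t j - Q (t i)))"
    using assms(2) by (simp add: digit_set_matrix_def translate_def)
  have "translate (A j) (t j) =
      (\<Union>i\<in>UNIV. translates (Q ` translate (A i) (t i)) (translate (D i j) (t j - Q (t i))))" for j
    \<comment> \<open>The equation for \<open>A j\<close> is used just once, on the left: its right
      side again contains the sets \<open>A i\<close>, so unrestricted rewriting would not
      end.\<close>
    by (subst A(3)) (simp only: translate_UN translates_linear_translate[OF Q])
  moreover have "translate (A j) (t j) \<noteq> {}" for j
    using A(1) by (simp add: translate_def)
  ultimately show "ifs_solution Q (\<lambda>i j. translate (D i j) (t j - Q (t i))) (\<lambda>j. translate (A j) (t j))"
    unfolding ifs_solution_def using A(2) compact_translate by blast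
qed

end
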